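(* Let $n\ge 2$ be an integer and let $a=a_0+a_1\mathbf{e}_1+a_2\mathbf{e}_2+a_3\mathbf{e}_3\in S_5\setminus\{0\}$. Then the equation $w^n=a$, with unknown $w\in C\ell_2$, has solutions: (i) $w=\sqrt[n]{a_0}+\dfrac{\Im(a)}{(\sqrt[n]{a_0})^{n-1}}$ if $a_0\neq 0$ and $n$ is odd; (ii) $w=\sqrt[n]{a_0}+\dfrac{\Im(a)}{(\sqrt[n]{a_0})^{n-1}}$ if $a_0>0$ and $n$ is even; (iii) $w=\sqrt[n]{a_0}\big(\cos\frac{2m\pi}{n}+\varepsilon\sin\frac{2m\pi}{n}\big)$, $m=0,1,\ldots,n-1$, for all $\varepsilon\in E_{-1}$, if $a=a_0>0$; (iv) $w=\sqrt[n]{-a_0}\big(\cos\frac{\pi+2m\pi}{n}+\varepsilon\sin\frac{\pi+2m\pi}{n}\big)$, $m=0,1,\ldots,n-1$, for all $\varepsilon\in E_{-1}$, if $a=a_0<0$.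
   Context: $C\ell_2=C\ell_{2,0}$ is the associative unital real algebra with $\mathbb{R}$-basis $\mathbf{e}_0=1,\mathbf{e}_1,\mathbf{e}_2,\mathbf{e}_3$ and multiplication rules $\mathbf{e}_1^2=\mathbf{e}_2^2=1$, $\mathbf{e}_3^2=-1$, $\mathbf{e}_1\mathbf{e}_2=\mathbf{e}_3=-\mathbf{e}_2\mathbf{e}_1$, $\mathbf{e}_2\mathbf{e}_3=-\mathbf{e}_1=-\mathbf{e}_3\mathbf{e}_2$, $\mathbf{e}_3\mathbf{e}_1=-\mathbf{e}_2=-\mathbf{e}_1\mathbf{e}_3$. For $a=a_0+a_1\mathbf{e}_1+a_2\mathbf{e}_2+a_3\mathbf{e}_3$ with $a_i\in\mathbb{R}$: $\Im(a)=a_1\mathbf{e}_1+a_2\mathbf{e}_2+a_3\mathbf{e}_3$ and $V_a=a_1^2+a_2^2-a_3^2$. $S_5=\{a\in C\ell_2: V_a=0\}$. $E_{-1}=\{\epsilon_1\mathbf{e}_1+\epsilon_2\mathbf{e}_2+\epsilon_3\mathbf{e}_3:\epsilon_i\in\mathbb{R},\ \epsilon_1^2+\epsilon_2^2-\epsilon_3^2=-1\}$. "$a=a_0$" means $\Im(a)=0$. $\sqrt[n]{\cdot}$ is the real $n$th root (the nonnegative one if $n$ is even; possibly negative if $n$ is odd).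
   Formalization: In (i) and (ii) the denominator is n times the (n−1)th power of the nth root of a_0, instead of that power alone; as printed both items fail whenever Im(a) ≠ 0, e.g. a = 1+e_1+e_3, n = 2, where w^2 = 1+2(e_1+e_3). *)

theory Defs
  imports Complex_Main
begin

text \<open>The real Clifford algebra of signature (2,0), as coordinate tuples with respect to the
  basis 1, e1, e2, e3 = e1 e2.\<close>

datatype cl2 = Cl2 (co0: real) (co1: real) (co2: real) (co3: real)

lemma cl2_eq_iff: "a = b \<longleftrightarrow> co0 a = co0 b \<and> co1 a = co1 b \<and> co2 a = co2 b \<and> co3 a = co3 b"
  by (cases a; cases b) simp

instantiation cl2 :: real_algebra_1
begin

definition "0 = Cl2 0 0 0 0"
definition "1 = Cl2 1 0 0 0"
definition "a + b = Cl2 (co0 a + co0 b) (co1 a + co1 b) (co2 a + co2 b) (co3 a + co3 b)"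
definition "- a = Cl2 (- co0 a) (- co1 a) (- co2 a) (- co3 a)"
definition "a - b = Cl2 (co0 a - co0 b) (co1 a - co1 b) (co2 a - co2 b) (co3 a - co3 b)"
definition "scaleR r a = Cl2 (r * co0 a) (r * co1 a) (r * co2 a) (r * co3 a)"

(* the bilinear extension of the multiplication table stated in cl2_table below *)
definition "a * b = Cl2
  (co0 a * co0 b + co1 a * co1 b + co2 a * co2 b - co3 a * co3 b)
  (co0 a * co1 b + co1 a * co0 b - co2 a * co3 b + co3 a * co2 b)
  (co0 a * co2 b + co2 a * co0 b + co1 a * co3 b - co3 a * co1 b)
  (co0 a * co3 b + co3 a * co0 b + co1 a * co2 b - co2 a * co1 b)"

instance
  by standard
    (simp_all add: cl2_eq_iff zero_cl2_def one_cl2_def plus_cl2_def uminus_cl2_def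
      minus_cl2_def scaleR_cl2_def times_cl2_def algebra_simps)

end

definition e1 :: cl2 where "e1 = Cl2 0 1 0 0"
definition e2 :: cl2 where "e2 = Cl2 0 0 1 0"
definition e3 :: cl2 where "e3 = Cl2 0 0 0 1"

lemma cl2_table:
  "e1 * e1 = 1" "e2 * e2 = 1" "e3 * e3 = - 1"
  "e1 * e2 = e3" "e2 * e1 = - e3"
  "e2 * e3 = - e1" "e3 * e2 = e1"
  "e3 * e1 = - e2" "e1 * e3 = e2"
  by (simp_all add: cl2_eq_iff e1_def e2_def e3_def one_cl2_def uminus_cl2_def times_cl2_def)

lemma cl2_expand: "a = of_real (co0 a) + co1 a *\<^sub>R e1 + co2 a *\<^sub>R e2 + co3 a *\<^sub>R e3"
  by (simp add: cl2_eq_iff of_real_def e1_def e2_def e3_def one_cl2_def plus_cl2_def scaleR_cl2_def)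

definition imag_part :: "cl2 \<Rightarrow> cl2" where
  "imag_part a = co1 a *\<^sub>R e1 + co2 a *\<^sub>R e2 + co3 a *\<^sub>R e3"

definition V :: "cl2 \<Rightarrow> real" where
  "V a = (co1 a)\<^sup>2 + (co2 a)\<^sup>2 - (co3 a)\<^sup>2"

(* A v with real part 0 and V v = 0 satisfies v * v = 0, hence
   (x + v) ^ n = x ^ n + n * x ^ (n - 1) * v for real x.  The nth root of a
   in S5 with real part r ^ n is therefore r + imag_part a / (n * r ^ (n - 1)); the factor n
   is essential: for n = 2 the square of 1 + e1 + e3 is 1 + 2 * (e1 + e3). *)
definition S5 :: "cl2 set" where
  "S5 = {a. V a = 0}"

definition E_minus1 :: "cl2 set" where
  "E_minus1 = {x *\<^sub>R e1 + y *\<^sub>R e2 + z *\<^sub>R e3 | x y z :: real. x\<^sup>2 + y\<^sup>2 - z\<^sup>2 = - 1}"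

end

(* An imaginary part v of an element of S5 satisfies v * v = 0, so the binomial expansion of
   (x + v) ^ n stops after the linear term.  An element e of E_minus1 satisfies e * e = - 1, so it
   spans with 1 a copy of the complex numbers, in which de Moivre's formula holds. *)
theory Submission imports Defs begin

lemma power_of_scaleR:
  fixes v :: "'a::real_algebra_1"
  shows "(r *\<^sub>R v) ^ n = r ^ n *\<^sub>R v ^ n"
  by (induction n) (simp_all add: mult.commute)

lemma power_of_real_plus_square_zero:
  fixes v :: "'a::real_algebra_1"
  assumes "v * v = 0"
  shows "(of_real x + v) ^ n = of_real (x ^ n) + (real n * x ^ (n - 1)) *\<^sub>R v"
proof (induction n)
  case 0
  show ?case by simp
next
  case (Suc n)
  \<comment> \<open>The case split handles truncated subtraction: \<open>n - 1\<close> is 0 at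
    \<open>n = 0\<close>, but the factor \<open>real n\<close> vanishes there; otherwise
    \<open>x * x ^ (n - 1)\<close> is \<open>x ^ n\<close>.\<close>
  have "x * (real n * x ^ (n - 1)) + x ^ n = real (Suc n) * x ^ n"
    by (cases n) (simp_all add: algebra_simps)
  then have coeff: "(x * (real n * x ^ (n - 1))) *\<^sub>R v + x ^ n *\<^sub>R v = (real (Suc n) * x ^ n) *\<^sub>R v"
    by (metis scaleR_left_distrib)
  have "(of_real x + v) ^ Suc n
      = (x *\<^sub>R 1 + v) * (x ^ n *\<^sub>R 1 + (real n * x ^ (n - 1)) *\<^sub>R v)"
    using Suc by (simp add: of_real_def)
  also have "\<dots> = of_real (x ^ Suc n)
      + ((x * (real n * x ^ (n - 1))) *\<^sub>R v + x ^ n *\<^sub>R v)"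
    using assms by (simp add: of_real_def distrib_left distrib_right scaleR_right_distrib mult.commute)
  finally show ?case using coeff by simp
qed

text \<open>Induction on \<open>n\<close> by the addition formulas: \<open>e * e = - 1\<close>
  supplies the minus sign in the formula for the cosine of a sum.\<close>

lemma cos_sin_power:
  fixes e :: "'a::real_algebra_1"
  assumes "e * e = - 1"
  shows "(of_real (cos t) + sin t *\<^sub>R e) ^ n = of_real (cos (real n * t)) + sin (real n * t) *\<^sub>R e"
proof (induction n)
  case 0
  show ?case by simp
next
  case (Suc n)
  have angle: "real (Suc n) * t = t + real n * t"
    by (simp add: algebra_simps)
  have "(of_real (cos t) + sin t *\<^sub>R e) ^ Suc n
      = (cos t *\<^sub>R 1 + sin t *\<^sub>R e) * (cos (real n * t) *\<^sub>R 1 + sin (real n * t) *\<^sub>R e)"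
    using Suc by (simp add: of_real_def)
  also have "\<dots> = of_real (cos (real (Suc n) * t)) + sin (real (Suc n) * t) *\<^sub>R e"
    using assms unfolding angle cos_add sin_add
    by (simp add: of_real_def distrib_left distrib_right algebra_simps)
  finally show ?case .
qed

lemma imag_part_coords: "imag_part a = Cl2 0 (co1 a) (co2 a) (co3 a)"
  by (simp add: cl2_eq_iff imag_part_def e1_def e2_def e3_def plus_cl2_def scaleR_cl2_def)

lemma cl2_real_plus_imag: "of_real (co0 a) + imag_part a = a"
  by (simp add: cl2_eq_iff of_real_def one_cl2_def plus_cl2_def scaleR_cl2_def imag_part_coords)

text \<open>Distinct elements among \<open>e1\<close>, \<open>e2\<close>, \<open>e3\<close>
  anticommute, so the mixed terms cancel and only the squares, with signs +, +, -, remain.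
  Membership in \<open>S5\<close> thus means that the imaginary part squares to zero.\<close>

lemma imag_part_square: "imag_part a * imag_part a = of_real (V a)"
  by (simp add: cl2_eq_iff of_real_def one_cl2_def scaleR_cl2_def imag_part_coords times_cl2_def
      V_def power2_eq_square)

lemma E_minus1_square:
  assumes "\<epsilon> \<in> E_minus1"
  shows "\<epsilon> * \<epsilon> = - 1"
  using assms
  by (auto simp: E_minus1_def cl2_eq_iff e1_def e2_def e3_def one_cl2_def plus_cl2_def
      uminus_cl2_def scaleR_cl2_def times_cl2_def power2_eq_square)

text \<open>Shared by the odd and the even case: parity of \<open>n\<close> and sign of
  \<open>co0 a\<close> enter only through the assumption that the real root is a genuine
  \<open>n\<close>th root.\<close>

lemma root_plus_imag_part_power:
  assumes "V a = 0" and "root n (co0 a) ^ n = co0 a" and "co0 a \<noteq> 0" and "n > 0"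
  shows "(of_real (root n (co0 a)) + imag_part a /\<^sub>R (real n * root n (co0 a) ^ (n - 1))) ^ n = a"
proof -
  \<comment> \<open>This is the coefficient of the linear term in the expansion, so dividing the
    imaginary part by it beforehand makes the power return exactly
    \<open>imag_part a\<close>.\<close>
  define c where "c = real n * root n (co0 a) ^ (n - 1)"
  have "c \<noteq> 0"
    using assms by (auto simp: c_def)
  have "(imag_part a /\<^sub>R c) * (imag_part a /\<^sub>R c) = 0"
    using assms(1) by (simp add: imag_part_square)
  then have "(of_real (root n (co0 a)) + imag_part a /\<^sub>R c) ^ n
      = of_real (co0 a) + c *\<^sub>R (imag_part a /\<^sub>R c)"
    using power_of_real_plus_square_zero assms(2) c_def by metis
  also have "\<dots> = a"
    using \<open>c \<noteq> 0\<close> by (simp add: cl2_real_plus_imag)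
  finally show ?thesis by (simp add: c_def)
qed

text \<open>Used with \<open>s = 1\<close> for positive and \<open>s = - 1\<close> for negative
  \<open>co0 a\<close>. As the sine of \<open>real n * t\<close> vanishes, \<epsilon> drops out of
  the power, which is why every \<epsilon> yields a root.\<close>

lemma root_cos_sin_power:
  assumes "\<epsilon> \<in> E_minus1" and "x \<ge> 0" and "n > 0"
    and "cos (real n * t) = s" and "sin (real n * t) = 0"
  shows "(root n x *\<^sub>R (of_real (cos t) + sin t *\<^sub>R \<epsilon>)) ^ n = of_real (x * s)"
proof -
  have "(root n x *\<^sub>R (of_real (cos t) + sin t *\<^sub>R \<epsilon>)) ^ n
      = root n x ^ n *\<^sub>R (of_real (cos (real n * t)) + sin (real n * t) *\<^sub>R \<epsilon>)"
    by (simp only: power_of_scaleR cos_sin_power[OF E_minus1_square[OF assms(1)]])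
  then show ?thesis
    using assms by (simp add: of_real_def)
qed

theorem theorem3p5:
  fixes n :: nat and a :: cl2
  assumes "n \<ge> 2" and "a \<in> S5 - {0}"
  shows
    "(co0 a \<noteq> 0 \<and> odd n \<longrightarrow>
        (of_real (root n (co0 a)) + imag_part a /\<^sub>R (real n * root n (co0 a) ^ (n - 1))) ^ n = a) \<and>
     (co0 a > 0 \<and> even n \<longrightarrow>
        (of_real (root n (co0 a)) + imag_part a /\<^sub>R (real n * root n (co0 a) ^ (n - 1))) ^ n = a) \<and>
     (imag_part a = 0 \<and> co0 a > 0 \<longrightarrow>
        (\<forall>m<n. \<forall>\<epsilon>\<in>E_minus1.
          (root n (co0 a) *\<^sub>R
            (of_real (cos (2 * real m * pi / real n))
              + sin (2 * real m * pi / real n) *\<^sub>R \<epsilon>)) ^ n = a)) \<and>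
     (imag_part a = 0 \<and> co0 a < 0 \<longrightarrow>
        (\<forall>m<n. \<forall>\<epsilon>\<in>E_minus1.
          (root n (- co0 a) *\<^sub>R
            (of_real (cos ((pi + 2 * real m * pi) / real n))
              + sin ((pi + 2 * real m * pi) / real n) *\<^sub>R \<epsilon>)) ^ n = a))"
proof (intro conjI impI allI ballI)
  have V: "V a = 0" and n: "n > 0"
    using assms by (auto simp: S5_def)
  {
    assume "co0 a \<noteq> 0 \<and> odd n"
    then show "(of_real (root n (co0 a)) + imag_part a /\<^sub>R (real n * root n (co0 a) ^ (n - 1))) ^ n = a"
      \<comment> \<open>For odd \<open>n\<close> the real root inverts the power on negative reals
        too, so no sign condition arises.\<close>
      using V n by (intro root_plus_imag_part_power) (auto simp: odd_real_root_pow)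
  next
    assume "co0 a > 0 \<and> even n"
    then show "(of_real (root n (co0 a)) + imag_part a /\<^sub>R (real n * root n (co0 a) ^ (n - 1))) ^ n = a"
      using V n by (intro root_plus_imag_part_power) auto
  next
    fix m \<epsilon>
    assume a: "imag_part a = 0 \<and> co0 a > 0" and \<epsilon>: "\<epsilon> \<in> E_minus1"
    let ?t = "2 * real m * pi / real n"
    have t: "real n * ?t = 2 * real m * pi"
      using n by simp
    \<comment> \<open>The factor 1 is the value of \<open>s\<close>, the cosine of a multiple of
      \<open>2 * pi\<close>.\<close>
    have "(root n (co0 a) *\<^sub>R (of_real (cos ?t) + sin ?t *\<^sub>R \<epsilon>)) ^ n = of_real (co0 a * 1)"
      using a \<epsilon> n by (intro root_cos_sin_power) (simp_all only: t cos_2npi sin_2npi less_imp_le)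
    then show "(root n (co0 a) *\<^sub>R (of_real (cos ?t) + sin ?t *\<^sub>R \<epsilon>)) ^ n = a"
      using a cl2_real_plus_imag[of a] by simp
  next
    fix m \<epsilon>
    assume a: "imag_part a = 0 \<and> co0 a < 0" and \<epsilon>: "\<epsilon> \<in> E_minus1"
    let ?t = "(pi + 2 * real m * pi) / real n"
    \<comment> \<open>\<open>pi\<close> is put last to fit the half-period rules for cosine and
      sine.\<close>
    have t: "real n * ?t = 2 * real m * pi + pi"
      using n by simp
    have "cos (real n * ?t) = - 1" "sin (real n * ?t) = 0"
      by (simp_all only: t cos_periodic_pi sin_periodic_pi cos_2npi sin_2npi minus_zero)
    \<comment> \<open>The radicand is the positive number \<open>- co0 a\<close>; the cosine value
      \<open>- 1\<close> restores the sign of \<open>co0 a\<close>.\<close>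
    then have "(root n (- co0 a) *\<^sub>R (of_real (cos ?t) + sin ?t *\<^sub>R \<epsilon>)) ^ n = of_real (- co0 a * - 1)"
      using a \<epsilon> n by (intro root_cos_sin_power) auto
    then show "(root n (- co0 a) *\<^sub>R (of_real (cos ?t) + sin ?t *\<^sub>R \<epsilon>)) ^ n = a"
      using a cl2_real_plus_imag[of a] by simp
  }
qed

end
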